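(* Let $\mathcal{G}=(S,\mathcal{F},\mathcal{L})$ be a $p$-local compact group and set $\mathcal{R}=\mathcal{H}^\bullet(\mathcal{F}^c)$. Let $\mathcal{P}$ be a set of representatives for the $S$-conjugacy classes in $\mathcal{R}$, and for any $P,Q\in\mathcal{P}$ let $\mathcal{M}_{P,Q}$ be a set of representatives for the orbits of $N_S(Q)$ on $\mathcal{L}(P,Q)$ (acting by post-composition with $\widehat g$, $g\in N_S(Q)$). Let $(\Psi,\psi)\in\mathrm{Ad}(\mathcal{G})$ be an unstable Adams operation such that: (1) $\psi(P)=P$ for any $P\in\mathcal{P}$; (2) if $P\in\mathcal{P}$ then $\psi|_{N_S(P)}$ is an automorphism of $N_S(P)$ which induces the identity on $N_S(P)/P_0$; (3) $\Psi(\varphi)=\varphi$ for every $\varphi\in\mathcal{M}_{P,Q}$, where $P,Q\in\mathcal{P}$. Then $(\Psi,\psi)$ is special relative to $\mathcal{H}^\bullet(\mathcal{F}^c)$.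
   Context: **$p$-local compact groups.** Fix a prime $p$; $\mathbb{Z}/p^\infty=\bigcup_n\mathbb{Z}/p^n$, and $\mathbb{Z}_p$ is the ring of $p$-adic integers. A discrete $p$-torus of rank $r$ is a group isomorphic to $(\mathbb{Z}/p^\infty)^r$. A discrete $p$-toral group is a group $P$ with a normal discrete $p$-torus $P_0$ such that $P/P_0$ is a finite $p$-group; $P_0$ is unique and is called the identity component or maximal torus of $P$. The order of $P$ is the pair $(\mathrm{rk}(P_0),|P/P_0|)$, ordered lexicographically. Write $c_g(x)=gxg^{-1}$ and $N_S(P,Q)=\{g\in S: gPg^{-1}\le Q\}$. A fusion system $\mathcal{F}$ over a discrete $p$-toral group $S$ is a category whose objects are all subgroups of $S$, whose morphisms are group monomorphisms, with $\mathrm{Hom}_{\mathcal F}(P,Q)\supseteq\{c_g|_P: g\in N_S(P,Q)\}$, and such that each morphism is an isomorphism in $\mathcal{F}$ followed by an inclusion. $P,Q$ are $\mathcal{F}$-conjugate if isomorphic in $\mathcal{F}$. $P\le S$ is fully centralised (fully normalised) if the order of $C_S(P')$ (of $N_S(P')$) is at most that of $C_S(P)$ (of $N_S(P)$) for every $P'$ that is $\mathcal{F}$-conjugate to $P$. $\mathcal{F}$ is saturated if: (I) each fully normalised $P$ is fully centralised, and $\mathrm{Out}_{\mathcal F}(P)=\mathrm{Aut}_{\mathcal F}(P)/\mathrm{Inn}(P)$ is finite with $\mathrm{Out}_S(P)$ a Sylow $p$-subgroup; (II) if $\varphi\in\mathrm{Hom}_{\mathcal F}(P,S)$ and $\varphi(P)$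 is fully centralised then $\varphi$ extends to a morphism in $\mathrm{Hom}_{\mathcal F}(N_\varphi,S)$, where $N_\varphi=\{g\in N_S(P):\varphi c_g\varphi^{-1}\in\mathrm{Aut}_S(\varphi(P))\}$; (III) if $P_1\le P_2\le\cdots$ and $\varphi\in\mathrm{Hom}(\bigcup P_n,S)$ has $\varphi|_{P_n}\in\mathrm{Hom}_{\mathcal F}(P_n,S)$ for all $n$, then $\varphi\in\mathrm{Hom}_{\mathcal F}(\bigcup P_n,S)$. $P\le S$ is $\mathcal{F}$-centric if $C_S(P')=Z(P')$ for all $P'$ $\mathcal{F}$-conjugate to $P$; $\mathcal{F}^c$ is the full subcategory (or set) of $\mathcal{F}$-centric subgroups. A (centric) linking system $\mathcal{L}$ associated to $\mathcal{F}$ is a small category with objects the $\mathcal{F}$-centric subgroups, a functor $\pi:\mathcal{L}\to\mathcal{F}^c$ that is the identity on objects and surjective on morphisms, and monomorphisms $\delta_P:P\to\mathrm{Aut}_{\mathcal L}(P)$ such that: (A) $Z(P)$ acts freely on $\mathcal{L}(P,Q)$ by precomposition via $\delta_P$, and $\pi:\mathcal{L}(P,Q)\to\mathrm{Hom}_{\mathcal F}(P,Q)$ is the orbit map; (B) $\pi(\delta_P(g))=c_g$ for $g\in P$; (C) $\varphi\circ\delta_P(g)=\delta_Q(\pi(\varphi)(g))\circ\varphi$ for $\varphi\in\mathcal{L}(P,Q)$, $g\in P$. The $\delta_P$ extend to injections $N_S(P,Q)\to\mathcal{L}(P,Q)$, $g\mapsto\widehat g$ (fixed once and for all), with $\pi(\widehat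 g)=c_g$ and $\widehat g\circ\widehat h=\widehat{gh}$. All morphisms of $\mathcal{L}$ are monomorphisms and epimorphisms. A $p$-local compact group is a triple $\mathcal{G}=(S,\mathcal{F},\mathcal{L})$ with $\mathcal{F}$ a saturated fusion system over $S$ and $\mathcal{L}$ an associated linking system. Let $T=S_0$. **Unstable Adams operations.** $\mathrm{Ad}(S)\le\mathrm{Aut}(S)$ consists of those $\psi$ for which there is $\zeta=\deg(\psi)\in\mathbb{Z}_p^\times$ with $\psi(t)=t^\zeta$ for $t\in T$, and which induce the identity on $S/T$. $\mathrm{Ad}_{\mathrm{fus}}(S)$ is the subgroup of those $\psi\in\mathrm{Ad}(S)$ that are fusion preserving, i.e. $\psi\varphi\psi^{-1}\in\mathrm{Hom}_{\mathcal F}(\psi(P),S)$ for every $\varphi\in\mathrm{Hom}_{\mathcal F}(P,S)$. An (algebraic) unstable Adams operation on $\mathcal{G}$ is a pair $(\Psi,\psi)$ with $\psi\in\mathrm{Ad}_{\mathrm{fus}}(S)$ and $\Psi:\mathcal{L}\to\mathcal{L}$ a functor such that $\pi\circ\Psi=\psi_*\circ\pi$, where $\psi_*(P)=\psi(P)$, $\psi_*(\varphi)=\psi\varphi\psi^{-1}$, and $\Psi(\widehat g)=\widehat{\psi(g)}$ for all $\mathcal{F}$-centric $P,Q$ and $g\in N_S(P,Q)$. They form the group $\mathrm{Ad}(\mathcal{G})$. **Special operations.** For a set $\mathcal{R}\subseteq\mathcal{F}^c$ of subgroups closed under $\mathcal{F}$-conjugacy, $\mathcal{L}^{\mathcal R}$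 is the full subcategory of $\mathcal{L}$ on $\mathcal{R}$. $(\Psi,\psi)\in\mathrm{Ad}(\mathcal{G})$ is special relative to $\mathcal{R}$ if there are $\tau_P\in T$ for each $P\in\mathcal{R}$ and $\tau_\varphi\in Q_0$ for each $\varphi\in\mathcal{L}^{\mathcal R}(P,Q)$ such that $\psi(P)=\tau_PP\tau_P^{-1}$ for every $P\in\mathcal{R}$ and $\Psi(\varphi)=\widehat{\tau_Q}\circ\widehat{\tau_\varphi}\circ\varphi\circ\widehat{\tau_P}^{-1}$ for every $\varphi\in\mathcal{L}^{\mathcal R}(P,Q)$ (here $\widehat{\tau_P}\in\mathcal{L}(P,\psi(P))$, $\widehat{\tau_Q}\in\mathcal{L}(Q,\psi(Q))$). **The collection $\mathcal{H}^\bullet(\mathcal{F}^c)$.** Let $W=\mathrm{Aut}_{\mathcal F}(T)$ and let $p^e$ be the exponent of $S/T$. For $A\le T$ set $I(A)=\{t\in T: w(t)=t\text{ for all }w\in W\text{ with }w|_A=\mathrm{id}_A\}$, with identity component $I(A)_0$. For $P\le S$ set $P^{[e]}=\langle g^{p^e}:g\in P\rangle\le T$ and $P^\bullet=P\cdot I(P^{[e]})_0$. Then $\mathcal{H}^\bullet(\mathcal{F})=\{P^\bullet:P\le S\}$ and $\mathcal{H}^\bullet(\mathcal{F}^c)=\mathcal{H}^\bullet(\mathcal{F})\cap\mathcal{F}^c$; it is closed under $\mathcal{F}$-conjugacy. *)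

theory Defs
  imports Complex_Main "HOL-Algebra.Algebra"
begin

section \<open>The groups \<open>\<int>/p\<^sup>\<infinity>\<close> and \<open>\<int>\<^sub>p\<close>\<close>

text \<open>\<open>\<int>/p\<^sup>\<infinity>\<close> is realised as the group of complex roots of unity of \<open>p\<close>-power order.\<close>

definition prufer :: "nat \<Rightarrow> complex monoid"
  where "prufer p = \<lparr>carrier = {z. \<exists>n. z ^ (p ^ n) = 1}, monoid.mult = (*), one = 1\<rparr>"

text \<open>\<open>\<int>\<^sub>p\<close> is the inverse limit of the rings \<open>\<int>/p\<^sup>n\<close>: the \<open>n\<close>-th term of a
  sequence is the canonical representative of its residue modulo \<open>p\<^sup>n\<close>.\<close>

definition padic_ring :: "nat \<Rightarrow> (nat \<Rightarrow> int) ring"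
  where "padic_ring p =
    \<lparr>carrier = {x. \<forall>n. x n \<in> {0..<int p ^ n} \<and> x (Suc n) mod int p ^ n = x n},
     monoid.mult = (\<lambda>x y n. (x n * y n) mod int p ^ n),
     one = (\<lambda>n. 1 mod int p ^ n),
     ring.zero = (\<lambda>n. 0),
     ring.add = (\<lambda>x y n. (x n + y n) mod int p ^ n)\<rparr>"

text \<open>\<open>t\<^sup>\<zeta>\<close> for an element \<open>t\<close> of \<open>p\<close>-power order and a \<open>p\<close>-adic integer \<open>\<zeta>\<close>:
  if \<open>t\<close> has order \<open>p\<^sup>n\<close> then the exponent only matters modulo \<open>p\<^sup>n\<close>.\<close>

definition padic_pow :: "nat \<Rightarrow> ('a, 'b) monoid_scheme \<Rightarrow> 'a \<Rightarrow> (nat \<Rightarrow> int) \<Rightarrow> 'a"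
  where "padic_pow p G t \<zeta> = t [^]\<^bsub>G\<^esub> \<zeta> (LEAST n. t [^]\<^bsub>G\<^esub> (p ^ n) = \<one>\<^bsub>G\<^esub>)"


section \<open>Discrete \<open>p\<close>-toral groups\<close>

abbreviation subgrp :: "('a, 'b) monoid_scheme \<Rightarrow> 'a set \<Rightarrow> ('a, 'b) monoid_scheme"
  where "subgrp G P \<equiv> G\<lparr>carrier := P\<rparr>"

definition discrete_torus_of_rank :: "nat \<Rightarrow> nat \<Rightarrow> ('a, 'b) monoid_scheme \<Rightarrow> bool"
  where "discrete_torus_of_rank p r G \<longleftrightarrow> group G \<and> G \<cong> product_group {..<r} (\<lambda>_. prufer p)"

definition finite_p_group :: "nat \<Rightarrow> ('a, 'b) monoid_scheme \<Rightarrow> bool"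
  where "finite_p_group p G \<longleftrightarrow> group G \<and> finite (carrier G) \<and> (\<exists>k. order G = p ^ k)"

definition max_torus :: "nat \<Rightarrow> ('a, 'b) monoid_scheme \<Rightarrow> 'a set \<Rightarrow> bool"
  where "max_torus p G A \<longleftrightarrow>
    A \<lhd> G \<and> (\<exists>r. discrete_torus_of_rank p r (subgrp G A)) \<and> finite_p_group p (G Mod A)"

definition discrete_p_toral :: "nat \<Rightarrow> ('a, 'b) monoid_scheme \<Rightarrow> bool"
  where "discrete_p_toral p G \<longleftrightarrow> group G \<and> (\<exists>A. max_torus p G A)"

text \<open>The identity component \<open>P\<^sub>0\<close> of a subgroup \<open>P\<close> of \<open>G\<close>. If \<open>P\<close> is discrete
  \<open>p\<close>-toral the union has exactly one member; see \<open>id_comp_eq\<close> below.\<close>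

definition id_comp :: "nat \<Rightarrow> ('a, 'b) monoid_scheme \<Rightarrow> 'a set \<Rightarrow> 'a set"
  where "id_comp p G P = \<Union> {A. max_torus p (subgrp G P) A}"

lemma root_in_prufer:
  assumes "x \<in> carrier (prufer p)" and "p > 0"
  shows "\<exists>y \<in> carrier (prufer p). y ^ (p ^ k) = x"
proof -
  obtain n where n: "x ^ (p ^ n) = 1"
    using assms by (auto simp: prufer_def)
  obtain r a where x: "x = rcis r a"
    using rcis_Ex by blast
  have "r \<noteq> 0"
    using n x assms(2) by (auto simp: zero_power)
  define s where "s = (if r > 0 then r else - r)"
  have "\<exists>b. x = rcis s b"
  proof (cases "r > 0")
    case True
    then show ?thesis using x s_def by auto
  next
    case False
    then have "x = rcis s (a + pi)"
      using x by (simp add: s_def rcis_def complex_eq_iff)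
    then show ?thesis by blast
  qed
  then obtain b where b: "x = rcis s b" by blast
  have "s > 0" using \<open>r \<noteq> 0\<close> by (auto simp: s_def)
  have pk: "p ^ k > 0" using assms(2) by simp
  define y where "y = rcis (root (p ^ k) s) (b / real (p ^ k))"
  have y: "y ^ (p ^ k) = x"
    using \<open>s > 0\<close> pk assms(2)
    unfolding y_def DeMoivre2 b by (simp add: real_root_pow_pos)
  then have "y ^ (p ^ (k + n)) = 1"
    using n by (simp add: power_add power_mult)
  with y show ?thesis
    unfolding prufer_def by (intro bexI[of _ y]) auto
qed

lemma discrete_torus_divisible:
  assumes "discrete_torus_of_rank p r G" and "p > 0" and "x \<in> carrier G"
  shows "\<exists>y \<in> carrier G. y [^]\<^bsub>G\<^esub> (p ^ k) = x"
proof -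
  let ?H = "product_group {..<r} (\<lambda>_. prufer p)"
  interpret G: group G using assms by (simp add: discrete_torus_of_rank_def)
  obtain h where h: "h \<in> iso G ?H"
    using assms by (auto simp: discrete_torus_of_rank_def is_iso_def)
  then have hom: "h \<in> hom G ?H" and bij: "bij_betw h (carrier G) (carrier ?H)"
    by (auto simp: iso_def)
  have pow: "h (y [^]\<^bsub>G\<^esub> (n::nat)) i = h y i ^ n"
    if "y \<in> carrier G" "i < r" "n > 0" for y i n
    using that(3)
  proof (induction n rule: nat_induct_non_zero)
    case 1
    then show ?case using that by simp
  next
    case (Suc n)
    then show ?case
      using hom_mult[OF hom, of "y [^]\<^bsub>G\<^esub> n" y] that by (simp add: prufer_def)
  qed
  have hx: "h x \<in> carrier ?H" using bij assms(3) by (auto simp: bij_betw_def)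
  then have "\<forall>i\<in>{..<r}. \<exists>z \<in> carrier (prufer p). z ^ (p ^ k) = h x i"
    using root_in_prufer assms(2) by (metis PiE_mem carrier_product_group)
  then obtain z where z: "\<And>i. i < r \<Longrightarrow> z i \<in> carrier (prufer p) \<and> z i ^ (p ^ k) = h x i"
    by (metis lessThan_iff)
  have "restrict z {..<r} \<in> carrier ?H" using z by auto
  then obtain y where y: "y \<in> carrier G" "h y = restrict z {..<r}"
    using bij by (metis bij_betw_imp_surj_on imageE)
  have hyx: "h (y [^]\<^bsub>G\<^esub> (p ^ k)) = h x"
  proof (rule PiE_ext)
    show "h (y [^]\<^bsub>G\<^esub> (p ^ k)) \<in> (\<Pi>\<^sub>E i\<in>{..<r}. carrier (prufer p))"
      using bij_betw_apply[OF bij, of "y [^]\<^bsub>G\<^esub> (p ^ k)"] y(1) by simp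
    show "h x \<in> (\<Pi>\<^sub>E i\<in>{..<r}. carrier (prufer p))"
      using hx by simp
    show "h (y [^]\<^bsub>G\<^esub> (p ^ k)) i = h x i" if "i \<in> {..<r}" for i
      using that y z pow[of y i "p ^ k"] assms(2) by simp
  qed
  have "y [^]\<^bsub>G\<^esub> (p ^ k) = x"
    using bij hyx assms(3) y(1) by (auto simp: bij_betw_def inj_on_def)
  with y(1) show ?thesis by blast
qed

lemma max_torus_le:
  assumes A: "max_torus p G A" and B: "max_torus p G B" and p: "p > 0"
  shows "A \<subseteq> B"
proof
  fix x assume x: "x \<in> A"
  interpret nB: normal B G using B by (simp add: max_torus_def)
  interpret nA: normal A G using A by (simp add: max_torus_def)
  interpret Q: group "G Mod B" by (rule nB.factorgroup_is_group)
  obtain r where tA: "discrete_torus_of_rank p r (subgrp G A)"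
    using A by (auto simp: max_torus_def)
  obtain k where k: "order (G Mod B) = p ^ k"
    using B by (auto simp: max_torus_def finite_p_group_def)
  obtain y where y: "y \<in> A" "y [^]\<^bsub>subgrp G A\<^esub> (p ^ k) = x"
    using discrete_torus_divisible[OF tA p, of x k] x by auto
  have yG: "y \<in> carrier G" using y(1) nA.subset by blast
  have x_eq: "x = y [^]\<^bsub>G\<^esub> (p ^ k)"
    using y(2) nB.nat_pow_consistent[of y "p ^ k" A] by simp
  have hom: "(\<lambda>a. B #>\<^bsub>G\<^esub> a) \<in> hom G (G Mod B)"
    by (rule nB.r_coset_hom_Mod)
  interpret h: group_hom G "G Mod B" "\<lambda>a. B #>\<^bsub>G\<^esub> a"
    using hom by unfold_locales
  have "B #>\<^bsub>G\<^esub> x = (B #>\<^bsub>G\<^esub> y) [^]\<^bsub>G Mod B\<^esub> (p ^ k)"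
    unfolding x_eq using h.hom_nat_pow yG by blast
  also have "\<dots> = B"
    using Q.pow_order_eq_1[of "B #>\<^bsub>G\<^esub> y"] h.hom_closed[OF yG] k by (simp add: FactGroup_def)
  finally have "B #>\<^bsub>G\<^esub> x = B" .
  then show "x \<in> B"
    using nB.rcos_self[OF subsetD[OF nA.subset x] nB.subgroup_axioms] by simp
qed

lemma id_comp_eq:
  assumes "max_torus p (subgrp G P) A" and "p > 0"
  shows "id_comp p G P = A"
  using max_torus_le[OF assms(1) _ assms(2)] max_torus_le[OF _ assms(1) assms(2)] assms(1)
  unfolding id_comp_def by blast

definition toral_rank :: "nat \<Rightarrow> ('a, 'b) monoid_scheme \<Rightarrow> 'a set \<Rightarrow> nat"
  where "toral_rank p G P = (THE r. discrete_torus_of_rank p r (subgrp G (id_comp p G P)))"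

definition toral_order :: "nat \<Rightarrow> ('a, 'b) monoid_scheme \<Rightarrow> 'a set \<Rightarrow> nat \<times> nat"
  where "toral_order p G P = (toral_rank p G P, order (subgrp G P Mod id_comp p G P))"

definition lex_le :: "nat \<times> nat \<Rightarrow> nat \<times> nat \<Rightarrow> bool"
  where "lex_le x y \<longleftrightarrow> fst x < fst y \<or> (fst x = fst y \<and> snd x \<le> snd y)"


section \<open>Conjugation, centralisers, \<open>p\<close>-subgroups\<close>

definition cj :: "('a, 'b) monoid_scheme \<Rightarrow> 'a \<Rightarrow> 'a \<Rightarrow> 'a"
  where "cj G g x = g \<otimes>\<^bsub>G\<^esub> x \<otimes>\<^bsub>G\<^esub> inv\<^bsub>G\<^esub> g"

definition transporter :: "('a, 'b) monoid_scheme \<Rightarrow> 'a set \<Rightarrow> 'a set \<Rightarrow> 'a set"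
  where "transporter G P Q = {g \<in> carrier G. cj G g ` P \<subseteq> Q}"

definition centraliser :: "('a, 'b) monoid_scheme \<Rightarrow> 'a set \<Rightarrow> 'a set"
  where "centraliser G P = {g \<in> carrier G. \<forall>x\<in>P. g \<otimes>\<^bsub>G\<^esub> x = x \<otimes>\<^bsub>G\<^esub> g}"

definition centre :: "('a, 'b) monoid_scheme \<Rightarrow> 'a set \<Rightarrow> 'a set"
  where "centre G P = {g \<in> P. \<forall>x\<in>P. g \<otimes>\<^bsub>G\<^esub> x = x \<otimes>\<^bsub>G\<^esub> g}"

definition sylow_subgroup :: "nat \<Rightarrow> ('a, 'b) monoid_scheme \<Rightarrow> 'a set \<Rightarrow> bool"
  where "sylow_subgroup p G H \<longleftrightarrow> subgroup H G \<and> card H = p ^ multiplicity p (order G)"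

definition group_exponent :: "('a, 'b) monoid_scheme \<Rightarrow> nat"
  where "group_exponent G = (LEAST n. n > 0 \<and> (\<forall>x\<in>carrier G. x [^]\<^bsub>G\<^esub> n = \<one>\<^bsub>G\<^esub>))"

definition representatives :: "('x \<Rightarrow> 'x \<Rightarrow> bool) \<Rightarrow> 'x set \<Rightarrow> 'x set \<Rightarrow> bool"
  where "representatives rep A M \<longleftrightarrow> M \<subseteq> A \<and> (\<forall>x\<in>A. \<exists>!y. y \<in> M \<and> rep x y)"


section \<open>Fusion systems\<close>

text \<open>A fusion system over \<open>S\<close> is given by its morphism sets \<open>F P Q\<close>. Morphisms are
  extensional functions (\<open>undefined\<close> outside \<open>P\<close>), so the composite of a morphism with
  an inclusion is the same function, and the codomain is recorded by \<open>F P Q\<close> only.\<close>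

type_synonym 'a homs = "'a set \<Rightarrow> 'a set \<Rightarrow> ('a \<Rightarrow> 'a) set"

definition fus_iso :: "'a homs \<Rightarrow> 'a set \<Rightarrow> 'a set \<Rightarrow> ('a \<Rightarrow> 'a) set"
  where "fus_iso F P Q = {\<phi> \<in> F P Q. \<exists>\<chi> \<in> F Q P.
    compose P \<chi> \<phi> = (\<lambda>x\<in>P. x) \<and> compose Q \<phi> \<chi> = (\<lambda>x\<in>Q. x)}"

definition fusion_system :: "nat \<Rightarrow> ('a, 'b) monoid_scheme \<Rightarrow> 'a homs \<Rightarrow> bool"
  where "fusion_system p S F \<longleftrightarrow>
    discrete_p_toral p S \<and>
    (\<forall>P Q. subgroup P S \<longrightarrow> subgroup Q S \<longrightarrow>
       F P Q \<subseteq> mon (subgrp S P) (subgrp S Q) \<inter> extensional P) \<and>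
    (\<forall>P Q. subgroup P S \<longrightarrow> subgroup Q S \<longrightarrow>
       (\<forall>g \<in> transporter S P Q. restrict (cj S g) P \<in> F P Q)) \<and>
    (\<forall>P Q R. subgroup P S \<longrightarrow> subgroup Q S \<longrightarrow> subgroup R S \<longrightarrow>
       (\<forall>\<phi> \<in> F P Q. \<forall>\<chi> \<in> F Q R. compose P \<chi> \<phi> \<in> F P R)) \<and>
    (\<forall>P Q. subgroup P S \<longrightarrow> subgroup Q S \<longrightarrow>
       (\<forall>\<phi> \<in> F P Q. \<exists>R. subgroup R S \<and> R \<subseteq> Q \<and> \<phi> \<in> fus_iso F P R))"

definition F_conjugate :: "('a, 'b) monoid_scheme \<Rightarrow> 'a homs \<Rightarrow> 'a set \<Rightarrow> 'a set \<Rightarrow> bool"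
  where "F_conjugate S F P Q \<longleftrightarrow> subgroup P S \<and> subgroup Q S \<and> fus_iso F P Q \<noteq> {}"

definition fully_centralised :: "nat \<Rightarrow> ('a, 'b) monoid_scheme \<Rightarrow> 'a homs \<Rightarrow> 'a set \<Rightarrow> bool"
  where "fully_centralised p S F P \<longleftrightarrow> subgroup P S \<and>
    (\<forall>P'. F_conjugate S F P P' \<longrightarrow>
       lex_le (toral_order p S (centraliser S P')) (toral_order p S (centraliser S P)))"

definition fully_normalised :: "nat \<Rightarrow> ('a, 'b) monoid_scheme \<Rightarrow> 'a homs \<Rightarrow> 'a set \<Rightarrow> bool"
  where "fully_normalised p S F P \<longleftrightarrow> subgroup P S \<and>
    (\<forall>P'. F_conjugate S F P P' \<longrightarrow>
       lex_le (toral_order p S (normalizer S P')) (toral_order p S (normalizer S P)))"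

definition Aut_F :: "'a homs \<Rightarrow> 'a set \<Rightarrow> ('a \<Rightarrow> 'a) monoid"
  where "Aut_F F P = subgrp (BijGroup P) (fus_iso F P P)"

definition Inn :: "('a, 'b) monoid_scheme \<Rightarrow> 'a set \<Rightarrow> ('a \<Rightarrow> 'a) set"
  where "Inn S P = (\<lambda>g. restrict (cj S g) P) ` P"

definition Aut_S :: "('a, 'b) monoid_scheme \<Rightarrow> 'a set \<Rightarrow> ('a \<Rightarrow> 'a) set"
  where "Aut_S S P = (\<lambda>g. restrict (cj S g) P) ` normalizer S P"

definition Out_F :: "('a, 'b) monoid_scheme \<Rightarrow> 'a homs \<Rightarrow> 'a set \<Rightarrow> ('a \<Rightarrow> 'a) set monoid"
  where "Out_F S F P = Aut_F F P Mod Inn S P"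

definition Out_S :: "('a, 'b) monoid_scheme \<Rightarrow> 'a homs \<Rightarrow> 'a set \<Rightarrow> ('a \<Rightarrow> 'a) set set"
  where "Out_S S F P = (\<lambda>\<alpha>. Inn S P #>\<^bsub>Aut_F F P\<^esub> \<alpha>) ` Aut_S S P"

text \<open>The group \<open>N\<^sub>\<phi>\<close>; the function below is \<open>\<phi> c\<^sub>g \<phi>\<^sup>-\<^sup>1\<close> on \<open>\<phi>(P)\<close>.\<close>

definition ext_dom :: "('a, 'b) monoid_scheme \<Rightarrow> 'a set \<Rightarrow> ('a \<Rightarrow> 'a) \<Rightarrow> 'a set"
  where "ext_dom S P \<phi> = {g \<in> normalizer S P.
    (\<lambda>y \<in> \<phi> ` P. \<phi> (cj S g (inv_into P \<phi> y))) \<in> Aut_S S (\<phi> ` P)}"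

definition saturated :: "nat \<Rightarrow> ('a, 'b) monoid_scheme \<Rightarrow> 'a homs \<Rightarrow> bool"
  where "saturated p S F \<longleftrightarrow>
    (\<forall>P. fully_normalised p S F P \<longrightarrow>
       fully_centralised p S F P \<and> finite (carrier (Out_F S F P)) \<and>
       sylow_subgroup p (Out_F S F P) (Out_S S F P)) \<and>
    (\<forall>P. \<forall>\<phi> \<in> F P (carrier S). subgroup P S \<longrightarrow> fully_centralised p S F (\<phi> ` P) \<longrightarrow>
       (\<exists>\<phi>' \<in> F (ext_dom S P \<phi>) (carrier S). \<forall>x\<in>P. \<phi>' x = \<phi> x)) \<and>
    (\<forall>(P :: nat \<Rightarrow> 'a set) \<phi>. (\<forall>n. subgroup (P n) S \<and> P n \<subseteq> P (Suc n)) \<longrightarrow>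
       \<phi> \<in> hom (subgrp S (\<Union>n. P n)) S \<inter> extensional (\<Union>n. P n) \<longrightarrow>
       (\<forall>n. restrict \<phi> (P n) \<in> F (P n) (carrier S)) \<longrightarrow>
       \<phi> \<in> F (\<Union>n. P n) (carrier S))"

definition centric :: "('a, 'b) monoid_scheme \<Rightarrow> 'a homs \<Rightarrow> 'a set set"
  where "centric S F = {P. subgroup P S \<and>
    (\<forall>P'. F_conjugate S F P P' \<longrightarrow> centraliser S P' = centre S P')}"


section \<open>Small categories\<close>

record ('o, 'm) category =
  Obj :: "'o set"
  Arr :: "'m set"
  Dom :: "'m \<Rightarrow> 'o"
  Cod :: "'m \<Rightarrow> 'o"
  Ide :: "'o \<Rightarrow> 'm"
  Cmp :: "'m \<Rightarrow> 'm \<Rightarrow> 'm"  (infixr \<open>\<cdot>\<index>\<close> 70)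

definition Mor :: "('o, 'm, 'z) category_scheme \<Rightarrow> 'o \<Rightarrow> 'o \<Rightarrow> 'm set"
  where "Mor C a b = {f \<in> Arr C. Dom C f = a \<and> Cod C f = b}"

definition is_category :: "('o, 'm, 'z) category_scheme \<Rightarrow> bool"
  where "is_category C \<longleftrightarrow>
    (\<forall>f \<in> Arr C. Dom C f \<in> Obj C \<and> Cod C f \<in> Obj C) \<and>
    (\<forall>a \<in> Obj C. Ide C a \<in> Mor C a a) \<and>
    (\<forall>a b c. \<forall>f \<in> Mor C a b. \<forall>g \<in> Mor C b c. g \<cdot>\<^bsub>C\<^esub> f \<in> Mor C a c) \<and>
    (\<forall>a b. \<forall>f \<in> Mor C a b. f \<cdot>\<^bsub>C\<^esub> Ide C a = f \<and> Ide C b \<cdot>\<^bsub>C\<^esub> f = f) \<and>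
    (\<forall>a b c d. \<forall>f \<in> Mor C a b. \<forall>g \<in> Mor C b c. \<forall>h \<in> Mor C c d.
       (h \<cdot>\<^bsub>C\<^esub> g) \<cdot>\<^bsub>C\<^esub> f = h \<cdot>\<^bsub>C\<^esub> (g \<cdot>\<^bsub>C\<^esub> f))"

definition is_inverse :: "('o, 'm, 'z) category_scheme \<Rightarrow> 'm \<Rightarrow> 'm \<Rightarrow> bool"
  where "is_inverse C f g \<longleftrightarrow> f \<in> Arr C \<and> g \<in> Mor C (Cod C f) (Dom C f) \<and>
    g \<cdot>\<^bsub>C\<^esub> f = Ide C (Dom C f) \<and> f \<cdot>\<^bsub>C\<^esub> g = Ide C (Cod C f)"

definition inverse_arr :: "('o, 'm, 'z) category_scheme \<Rightarrow> 'm \<Rightarrow> 'm"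
  where "inverse_arr C f = (THE g. is_inverse C f g)"

definition Aut_cat :: "('o, 'm, 'z) category_scheme \<Rightarrow> 'o \<Rightarrow> 'm monoid"
  where "Aut_cat C a =
    \<lparr>carrier = {f \<in> Mor C a a. \<exists>g. is_inverse C f g}, monoid.mult = Cmp C, one = Ide C a\<rparr>"

definition is_functor ::
    "('o, 'm, 'y) category_scheme \<Rightarrow> ('p, 'n, 'z) category_scheme \<Rightarrow>
     ('o \<Rightarrow> 'p) \<Rightarrow> ('m \<Rightarrow> 'n) \<Rightarrow> bool"
  where "is_functor C D Fo Fa \<longleftrightarrow>
    (\<forall>a \<in> Obj C. Fo a \<in> Obj D) \<and>
    (\<forall>a b. \<forall>f \<in> Mor C a b. Fa f \<in> Mor D (Fo a) (Fo b)) \<and>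
    (\<forall>a \<in> Obj C. Fa (Ide C a) = Ide D (Fo a)) \<and>
    (\<forall>a b c. \<forall>f \<in> Mor C a b. \<forall>g \<in> Mor C b c. Fa (g \<cdot>\<^bsub>C\<^esub> f) = Fa g \<cdot>\<^bsub>D\<^esub> Fa f)"


section \<open>Linking systems and \<open>p\<close>-local compact groups\<close>

text \<open>\<open>proj\<close> is the functor \<open>\<pi>\<close> on morphisms, \<open>dlt P\<close> is \<open>\<delta>\<^sub>P\<close>, and \<open>hat P Q g\<close>
  is the morphism \<open>P \<rightarrow> Q\<close> denoted by \<open>g\<close> with a hat, for \<open>g \<in> N\<^sub>S(P,Q)\<close>.\<close>

record ('a, 'm) linking = "('a set, 'm) category" +
  proj :: "'m \<Rightarrow> 'a \<Rightarrow> 'a"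
  dlt :: "'a set \<Rightarrow> 'a \<Rightarrow> 'm"
  hat :: "'a set \<Rightarrow> 'a set \<Rightarrow> 'a \<Rightarrow> 'm"

definition linking_system ::
    "('a, 'b) monoid_scheme \<Rightarrow> 'a homs \<Rightarrow> ('a, 'm, 'z) linking_scheme \<Rightarrow> bool"
  where "linking_system S F L \<longleftrightarrow>
    is_category L \<and> Obj L = centric S F \<and>
    \<comment> \<open>\<open>\<pi>\<close> is a functor, the identity on objects and surjective on morphisms\<close>
    (\<forall>P \<in> Obj L. \<forall>Q \<in> Obj L. proj L ` Mor L P Q = F P Q) \<and>
    (\<forall>P \<in> Obj L. proj L (Ide L P) = (\<lambda>x\<in>P. x)) \<and>
    (\<forall>P Q R. \<forall>\<phi> \<in> Mor L P Q. \<forall>\<chi> \<in> Mor L Q R.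
       proj L (\<chi> \<cdot>\<^bsub>L\<^esub> \<phi>) = compose P (proj L \<chi>) (proj L \<phi>)) \<and>
    (\<forall>P \<in> Obj L. dlt L P \<in> mon (subgrp S P) (Aut_cat L P)) \<and>
    \<comment> \<open>axiom (A)\<close>
    (\<forall>P Q. \<forall>\<phi> \<in> Mor L P Q. \<forall>z \<in> centre S P. \<phi> \<cdot>\<^bsub>L\<^esub> dlt L P z = \<phi> \<longrightarrow> z = \<one>\<^bsub>S\<^esub>) \<and>
    (\<forall>P Q. \<forall>\<phi> \<in> Mor L P Q. \<forall>\<phi>' \<in> Mor L P Q.
       proj L \<phi> = proj L \<phi>' \<longleftrightarrow> (\<exists>z \<in> centre S P. \<phi>' = \<phi> \<cdot>\<^bsub>L\<^esub> dlt L P z)) \<and>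
    \<comment> \<open>axiom (B)\<close>
    (\<forall>P \<in> Obj L. \<forall>g \<in> P. proj L (dlt L P g) = restrict (cj S g) P) \<and>
    \<comment> \<open>axiom (C)\<close>
    (\<forall>P Q. \<forall>\<phi> \<in> Mor L P Q. \<forall>g \<in> P.
       \<phi> \<cdot>\<^bsub>L\<^esub> dlt L P g = dlt L Q (proj L \<phi> g) \<cdot>\<^bsub>L\<^esub> \<phi>)"

text \<open>The chosen extension of the \<open>\<delta>\<^sub>P\<close> to injections \<open>N\<^sub>S(P,Q) \<rightarrow> \<L>(P,Q)\<close>.\<close>

definition hat_system ::
    "('a, 'b) monoid_scheme \<Rightarrow> ('a, 'm, 'z) linking_scheme \<Rightarrow> bool"
  where "hat_system S L \<longleftrightarrow>
    (\<forall>P \<in> Obj L. \<forall>Q \<in> Obj L.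
       hat L P Q \<in> transporter S P Q \<rightarrow> Mor L P Q \<and> inj_on (hat L P Q) (transporter S P Q) \<and>
       (\<forall>g \<in> transporter S P Q. proj L (hat L P Q g) = restrict (cj S g) P)) \<and>
    (\<forall>P \<in> Obj L. \<forall>g \<in> P. hat L P P g = dlt L P g) \<and>
    (\<forall>P \<in> Obj L. \<forall>Q \<in> Obj L. \<forall>R \<in> Obj L.
       \<forall>h \<in> transporter S P Q. \<forall>g \<in> transporter S Q R.
         hat L Q R g \<cdot>\<^bsub>L\<^esub> hat L P Q h = hat L P R (g \<otimes>\<^bsub>S\<^esub> h))"

definition p_local_compact_group ::
    "nat \<Rightarrow> ('a, 'b) monoid_scheme \<Rightarrow> 'a homs \<Rightarrow> ('a, 'm, 'z) linking_scheme \<Rightarrow> bool"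
  where "p_local_compact_group p S F L \<longleftrightarrow>
    Factorial_Ring.prime p \<and> fusion_system p S F \<and> saturated p S F \<and> linking_system S F L \<and> hat_system S L"


section \<open>Unstable Adams operations\<close>

text \<open>\<open>g' \<in> N #> g\<close> says that \<open>g\<close> and \<open>g'\<close> have the same image modulo \<open>N\<close>.\<close>

definition Ad_S :: "nat \<Rightarrow> ('a, 'b) monoid_scheme \<Rightarrow> ('a \<Rightarrow> 'a) set"
  where "Ad_S p S = {\<psi> \<in> auto S.
    (\<exists>\<zeta> \<in> Units (padic_ring p). \<forall>t \<in> id_comp p S (carrier S). \<psi> t = padic_pow p S t \<zeta>) \<and>
    (\<forall>g \<in> carrier S. \<psi> g \<in> id_comp p S (carrier S) #>\<^bsub>S\<^esub> g)}"

text \<open>\<open>\<psi> \<phi> \<psi>\<^sup>-\<^sup>1\<close> as a function on \<open>\<psi>(P)\<close>.\<close>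

definition twist :: "('a, 'b) monoid_scheme \<Rightarrow> ('a \<Rightarrow> 'a) \<Rightarrow> 'a set \<Rightarrow> ('a \<Rightarrow> 'a) \<Rightarrow> 'a \<Rightarrow> 'a"
  where "twist S \<psi> P \<phi> = (\<lambda>y \<in> \<psi> ` P. \<psi> (\<phi> (inv_into (carrier S) \<psi> y)))"

definition Ad_fus :: "nat \<Rightarrow> ('a, 'b) monoid_scheme \<Rightarrow> 'a homs \<Rightarrow> ('a \<Rightarrow> 'a) set"
  where "Ad_fus p S F = {\<psi> \<in> Ad_S p S. \<forall>P. subgroup P S \<longrightarrow>
    (\<forall>\<phi> \<in> F P (carrier S). twist S \<psi> P \<phi> \<in> F (\<psi> ` P) (carrier S))}"

text \<open>The functor \<open>\<Psi>\<close> is given on morphisms; on objects it has to be \<open>P \<mapsto> \<psi>(P)\<close>,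
  because \<open>\<pi> \<circ> \<Psi> = \<psi>\<^sub>* \<circ> \<pi>\<close> and \<open>\<pi>\<close> is the identity on objects.\<close>

definition Ad ::
    "nat \<Rightarrow> ('a, 'b) monoid_scheme \<Rightarrow> 'a homs \<Rightarrow> ('a, 'm, 'z) linking_scheme \<Rightarrow>
     (('m \<Rightarrow> 'm) \<times> ('a \<Rightarrow> 'a)) set"
  where "Ad p S F L = {(\<Psi>, \<psi>).
    \<psi> \<in> Ad_fus p S F \<and>
    is_functor L L (\<lambda>P. \<psi> ` P) \<Psi> \<and>
    (\<forall>P Q. \<forall>\<phi> \<in> Mor L P Q. proj L (\<Psi> \<phi>) = twist S \<psi> P (proj L \<phi>)) \<and>
    (\<forall>P \<in> Obj L. \<forall>Q \<in> Obj L. \<forall>g \<in> transporter S P Q.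
       \<Psi> (hat L P Q g) = hat L (\<psi> ` P) (\<psi> ` Q) (\<psi> g))}"

definition special ::
    "nat \<Rightarrow> ('a, 'b) monoid_scheme \<Rightarrow> ('a, 'm, 'z) linking_scheme \<Rightarrow> 'a set set \<Rightarrow>
     ('m \<Rightarrow> 'm) \<times> ('a \<Rightarrow> 'a) \<Rightarrow> bool"
  where "special p S L \<R> = (\<lambda>(\<Psi>, \<psi>). \<exists>(\<tau> :: 'a set \<Rightarrow> 'a) (\<sigma> :: 'm \<Rightarrow> 'a).
    (\<forall>P \<in> \<R>. \<tau> P \<in> id_comp p S (carrier S) \<and> \<psi> ` P = cj S (\<tau> P) ` P) \<and>
    (\<forall>P \<in> \<R>. \<forall>Q \<in> \<R>. \<forall>\<phi> \<in> Mor L P Q.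
       \<sigma> \<phi> \<in> id_comp p S Q \<and>
       \<Psi> \<phi> = hat L Q (\<psi> ` Q) (\<tau> Q) \<cdot>\<^bsub>L\<^esub> hat L Q Q (\<sigma> \<phi>) \<cdot>\<^bsub>L\<^esub> \<phi>
               \<cdot>\<^bsub>L\<^esub> inverse_arr L (hat L P (\<psi> ` P) (\<tau> P))))"


section \<open>The collection \<open>\<H>\<^sup>\<bullet>(\<F>\<^sup>c)\<close>\<close>

definition fix_closure :: "nat \<Rightarrow> ('a, 'b) monoid_scheme \<Rightarrow> 'a homs \<Rightarrow> 'a set \<Rightarrow> 'a set"
  where "fix_closure p S F A = (let T = id_comp p S (carrier S) in
    {t \<in> T. \<forall>w \<in> carrier (Aut_F F T). (\<forall>a\<in>A. w a = a) \<longrightarrow> w t = t})"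

text \<open>\<open>P\<^sup>[\<^sup>e\<^sup>]\<close>, where \<open>p\<^sup>e\<close> is the exponent of \<open>S/T\<close>.\<close>

definition power_subgroup :: "nat \<Rightarrow> ('a, 'b) monoid_scheme \<Rightarrow> 'a set \<Rightarrow> 'a set"
  where "power_subgroup p S P =
    generate S {g [^]\<^bsub>S\<^esub> group_exponent (S Mod id_comp p S (carrier S)) | g. g \<in> P}"

definition bullet :: "nat \<Rightarrow> ('a, 'b) monoid_scheme \<Rightarrow> 'a homs \<Rightarrow> 'a set \<Rightarrow> 'a set"
  where "bullet p S F P = P <#>\<^bsub>S\<^esub> id_comp p S (fix_closure p S F (power_subgroup p S P))"

definition H_bullet :: "nat \<Rightarrow> ('a, 'b) monoid_scheme \<Rightarrow> 'a homs \<Rightarrow> 'a set set"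
  where "H_bullet p S F = bullet p S F ` {P. subgroup P S}"

definition H_bullet_centric :: "nat \<Rightarrow> ('a, 'b) monoid_scheme \<Rightarrow> 'a homs \<Rightarrow> 'a set set"
  where "H_bullet_centric p S F = H_bullet p S F \<inter> centric S F"

end

(* Write P = gP'g^-1 with P' in the set of representatives, and put tau_P = psi(g)g^-1, an element
   of T because psi is the identity modulo T; then psi(P) = tau_P P tau_P^-1. Conjugating a morphism
   P -> Q by the chosen elements gives one of the form n^ o mu : P' -> Q' with mu fixed by Psi and n
   normalising Q'. Hence Psi changes it only by psi(n)n^-1, which lies in Q'_0, and transporting
   back this becomes the element of Q_0 required for a special operation. *)

theory Submission
  imports Defs
begin

section \<open>Identity components\<close>

text \<open>First isomorphism theorem for the composite of \<open>h\<close> with the quotient map of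
  \<open>H\<close>: it is onto because both factors are, and its kernel is exactly \<open>A\<close>
  because \<open>h\<close> is injective.\<close>

lemma Mod_iso_image:
  assumes h: "h \<in> iso G H" and "group H" and A: "A \<lhd> G"
  shows "G Mod A \<cong> H Mod (h ` A)"
proof -
  interpret A: normal A G using A .
  interpret H: group H by fact
  interpret h: group_hom G H h
    using h by unfold_locales (simp add: iso_def)
  have surj: "h ` carrier G = carrier H" and inj: "inj_on h (carrier G)"
    using h by (auto simp: iso_def bij_betw_def)
  have hA: "h ` A \<lhd> H"
    using A.surj_hom_normal_subgroup[OF h.group_hom_axioms surj] .
  interpret B: normal "h ` A" H using hA .
  interpret Q: group "H Mod (h ` A)" by (rule B.factorgroup_is_group)
  let ?q = "(\<lambda>a. h ` A #>\<^bsub>H\<^esub> a) \<circ> h"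
  interpret q: group_hom G "H Mod (h ` A)" ?q
    using Group.hom_compose[OF h.homh B.r_coset_hom_Mod] by unfold_locales
  have "?q ` carrier G = carrier (H Mod (h ` A))"
    unfolding image_comp[symmetric] surj by (auto simp: FactGroup_def RCOSETS_def)
  moreover have "kernel G (H Mod (h ` A)) ?q = A"
  proof -
    have "h ` A #>\<^bsub>H\<^esub> h x = h ` A \<longleftrightarrow> x \<in> A" if "x \<in> carrier G" for x
    proof -
      have "h ` A #>\<^bsub>H\<^esub> h x = h ` A \<longleftrightarrow> h x \<in> h ` A"
        using H.coset_join1 H.coset_join2 B.subgroup_axioms h.hom_closed[OF that] by blast
      also have "\<dots> \<longleftrightarrow> x \<in> A"
        using inj that A.subset by (meson inj_on_image_mem_iff)
      finally show ?thesis .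
    qed
    then show ?thesis
      using A.subset by (auto simp: kernel_def FactGroup_def)
  qed
  ultimately show ?thesis
    using q.FactGroup_iso by simp
qed

text \<open>Each clause of \<open>max_torus\<close> is invariant under isomorphism. The torus clause
  follows by transitivity of isomorphism. For the quotient a bijection of carriers is enough, since
  beyond being a group \<open>finite_p_group\<close> only sees finiteness and order.\<close>

lemma max_torus_iso_image:
  assumes h: "h \<in> iso G H" and G: "group G" and H: "group H" and A: "max_torus p G A"
  shows "max_torus p H (h ` A)"
proof -
  have nA: "A \<lhd> G" using A by (simp add: max_torus_def)
  have nB: "h ` A \<lhd> H"
    using iso_normal_subgroup[OF h G H nA] .
  interpret A: normal A G using nA .
  interpret B: normal "h ` A" H using nB .
  have gA: "group (subgrp G A)" and gB: "group (subgrp H (h ` A))"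
    using A.subgroup_is_group[OF G] B.subgroup_is_group[OF H] .
  have "subgrp G A \<cong> subgrp H (h ` A)"
    using iso_restrict[OF h G H A.subgroup_axioms] by (auto intro: is_isoI)
  then have iso: "subgrp H (h ` A) \<cong> subgrp G A"
    using group.iso_sym[OF gA] by blast
  have tor: "\<exists>r. discrete_torus_of_rank p r (subgrp H (h ` A))"
    using A gB iso iso_trans unfolding max_torus_def discrete_torus_of_rank_def by blast
  have gQ: "group (G Mod A)" "group (H Mod (h ` A))"
    using A.factorgroup_is_group B.factorgroup_is_group .
  obtain f where "bij_betw f (carrier (G Mod A)) (carrier (H Mod (h ` A)))"
    using Mod_iso_image[OF h H nA] by (auto simp: is_iso_def iso_def)
  then have "finite_p_group p (H Mod (h ` A))"
    using A gQ bij_betw_finite bij_betw_same_card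
    unfolding max_torus_def finite_p_group_def order_def by metis
  with nB tor show ?thesis by (simp add: max_torus_def)
qed

text \<open>\<open>id_comp\<close> is a union of normal subgroups of \<open>subgrp G P\<close>;
  should the union be empty, the inclusion is trivial.\<close>

lemma id_comp_subset: "id_comp p G P \<subseteq> P"
proof -
  have "A \<subseteq> P" if "A \<lhd> subgrp G P" for A
    using normal_imp_subgroup[OF that] subgroup.subset by fastforce
  then show ?thesis
    unfolding id_comp_def max_torus_def by blast
qed

section \<open>Conjugation as an action on elements and subgroups\<close>

lemma (in group) cj_closed [simp]: "g \<in> carrier G \<Longrightarrow> x \<in> carrier G \<Longrightarrow> cj G g x \<in> carrier G"
  by (simp add: cj_def)

lemma (in group) cj_mult:
  "g \<in> carrier G \<Longrightarrow> h \<in> carrier G \<Longrightarrow> x \<in> carrier G \<Longrightarrow> cj G (g \<otimes> h) x = cj G g (cj G h x)"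
  by (simp add: cj_def inv_mult_group m_assoc)

lemma (in group) cj_inv_cj [simp]:
  "g \<in> carrier G \<Longrightarrow> x \<in> carrier G \<Longrightarrow> cj G (inv g) (cj G g x) = x"
  by (simp add: cj_mult[symmetric]) (simp add: cj_def)

lemma (in group) inj_on_cj: "g \<in> carrier G \<Longrightarrow> inj_on (cj G g) (carrier G)"
  by (rule inj_on_inverseI[where g = "cj G (inv g)"]) simp

lemma (in group) cj_image_mult:
  assumes "g \<in> carrier G" "h \<in> carrier G" "P \<subseteq> carrier G"
  shows "cj G (g \<otimes> h) ` P = cj G g ` cj G h ` P"
  unfolding image_image using assms by (intro image_cong) (auto simp: cj_mult)

lemma (in group) cj_iso:
  assumes "g \<in> carrier G" and "P \<subseteq> carrier G"
  shows "cj G g \<in> iso (subgrp G P) (subgrp G (cj G g ` P))"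
proof -
  have "cj G g (x \<otimes> y) = cj G g x \<otimes> cj G g y" if "x \<in> carrier G" "y \<in> carrier G" for x y
    using assms that by (simp add: cj_def m_assoc) (simp add: m_assoc[symmetric])
  then have "cj G g \<in> hom (subgrp G P) (subgrp G (cj G g ` P))"
    using assms by (auto simp: hom_def)
  then show ?thesis
    using inj_on_subset[OF inj_on_cj] assms by (simp add: iso_def bij_betw_def)
qed

text \<open>Conjugation by \<open>g\<close> is an isomorphism from \<open>P\<close> to
  \<open>Q\<close>, so it sends every member of the union defining \<open>id_comp\<close> for
  \<open>P\<close> to a member of the union for \<open>Q\<close>. This is what moves a correction
  term from a representative to an arbitrary member of its conjugacy class.\<close>

lemma (in group) cj_id_comp:
  assumes P: "subgroup P G" and Q: "subgroup Q G" and g: "g \<in> carrier G"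
    and eq: "Q = cj G g ` P" and a: "a \<in> id_comp p G P"
  shows "cj G g a \<in> id_comp p G Q"
proof -
  obtain A where A: "max_torus p (subgrp G P) A" "a \<in> A"
    using a by (auto simp: id_comp_def)
  have "max_torus p (subgrp G Q) (cj G g ` A)"
    using max_torus_iso_image[OF _ _ _ A(1)] cj_iso[OF g subgroup.subset[OF P]]
      subgroup_imp_group[OF P] subgroup_imp_group[OF Q] unfolding eq by blast
  with A(2) show ?thesis by (auto simp: id_comp_def)
qed

lemma (in group) cj_image_inv:
  assumes "g \<in> carrier G" "P \<subseteq> carrier G" "Q = cj G g ` P"
  shows "cj G (inv g) ` Q = P"
proof -
  have "cj G (inv g) ` Q = (\<lambda>x. x) ` P"
    unfolding assms(3) image_image using assms(1,2) by (intro image_cong) auto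
  then show ?thesis by simp
qed

text \<open>Links the library normalizer, a stabilizer under the action by cosets, to the
  \<open>cj\<close> images used in \<open>transporter\<close>.\<close>

lemma (in group) normalizer_eq:
  assumes "P \<subseteq> carrier G"
  shows "normalizer G P = {g \<in> carrier G. cj G g ` P = P}"
proof -
  have "g <# P #> inv g = cj G g ` P" for g
    by (auto simp: l_coset_def r_coset_def cj_def)
  then show ?thesis
    using assms by (auto simp: normalizer_def stabilizer_def)
qed


(* Ideal_Product uses the same infix, which makes every composite ambiguous. *)
no_notation ideal_prod (infixl \<open>\<cdot>\<index>\<close> 80)

section \<open>Calculus of the morphisms \<open>hat g\<close>\<close>

lemma Cmp_Mor:
  assumes "is_category C" "f \<in> Mor C a b" "g \<in> Mor C b c"
  shows "g \<cdot>\<^bsub>C\<^esub> f \<in> Mor C a c"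
  using assms unfolding is_category_def by blast

lemma Cmp_assoc:
  fixes C :: "('o, 'm, 'z) category_scheme"
  assumes "is_category C" "f \<in> Mor C a b" "g \<in> Mor C b c" "h \<in> Mor C c d"
  shows "(h \<cdot>\<^bsub>C\<^esub> g) \<cdot>\<^bsub>C\<^esub> f = h \<cdot>\<^bsub>C\<^esub> g \<cdot>\<^bsub>C\<^esub> f"
  using assms unfolding is_category_def by blast

lemma Ide_Cmp:
  assumes "is_category C" "f \<in> Mor C a b"
  shows "f \<cdot>\<^bsub>C\<^esub> Ide C a = f" "Ide C b \<cdot>\<^bsub>C\<^esub> f = f"
  using assms unfolding is_category_def by blast+

text \<open>Any inverse \<open>g'\<close> of \<open>f\<close> equals \<open>g'\<close> after
  \<open>f\<close> after \<open>g\<close>, hence equals \<open>g\<close>; so the definite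
  description in \<open>inverse_arr\<close> is well defined.\<close>

lemma inverse_arr_eqI:
  assumes C: "is_category C" and f: "f \<in> Mor C a b" and g: "g \<in> Mor C b a"
    and "g \<cdot>\<^bsub>C\<^esub> f = Ide C a" "f \<cdot>\<^bsub>C\<^esub> g = Ide C b"
  shows "inverse_arr C f = g"
  unfolding inverse_arr_def
proof (rule the_equality)
  show "is_inverse C f g"
    using assms by (simp add: is_inverse_def Mor_def)
next
  fix g' assume "is_inverse C f g'"
  then have g': "g' \<in> Mor C b a" "g' \<cdot>\<^bsub>C\<^esub> f = Ide C a"
    using f by (auto simp: is_inverse_def Mor_def)
  have "g' = g' \<cdot>\<^bsub>C\<^esub> f \<cdot>\<^bsub>C\<^esub> g"
    using Ide_Cmp[OF C g'(1)] assms(5) by simp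
  also have "\<dots> = g"
    using Cmp_assoc[OF C g f g'(1)] g'(2) Ide_Cmp[OF C g] by simp
  finally show "g' = g" .
qed

lemma functor_Cmp:
  assumes "is_functor C D Fo Fa" "f \<in> Mor C a b" "g \<in> Mor C b c"
  shows "Fa (g \<cdot>\<^bsub>C\<^esub> f) = Fa g \<cdot>\<^bsub>D\<^esub> Fa f"
  using assms unfolding is_functor_def by blast

section \<open>Elements of transporters as morphisms of a linking system\<close>

locale hat_linking = group S
  for S :: "('a, 'b) monoid_scheme" (structure)
    and F :: "'a homs" and L :: "('a, 'm, 'z) linking_scheme" (structure) +
  assumes linking: "linking_system S F L" and hats: "hat_system S L"
begin

lemma category: "is_category L" and Obj_eq: "Obj L = centric S F"
  using linking by (simp_all add: linking_system_def)

lemma Obj_subgroup: "P \<in> Obj L \<Longrightarrow> subgroup P S"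
  by (simp add: Obj_eq centric_def)

lemma Obj_carrier: "P \<in> Obj L \<Longrightarrow> x \<in> P \<Longrightarrow> x \<in> carrier S"
  using subgroup.mem_carrier[OF Obj_subgroup] .

lemma hat_Mor:
  assumes "P \<in> Obj L" "Q \<in> Obj L" "g \<in> transporter S P Q"
  shows "hat L P Q g \<in> Mor L P Q"
proof -
  have "hat L P Q \<in> transporter S P Q \<rightarrow> Mor L P Q"
    using hats assms(1,2) by (simp add: hat_system_def)
  then show ?thesis using assms(3) by blast
qed

lemma transporter_mult:
  assumes "P \<subseteq> carrier S" "h \<in> transporter S P Q" "g \<in> transporter S Q R"
  shows "g \<otimes> h \<in> transporter S P R"
proof -
  have "cj S (g \<otimes> h) ` P = cj S g ` cj S h ` P"
    using assms by (intro cj_image_mult) (auto simp: transporter_def)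
  also have "\<dots> \<subseteq> R"
    using assms(2,3) unfolding transporter_def by blast
  finally show ?thesis
    using assms(2,3) by (simp add: transporter_def)
qed

lemma hat_hat:
  assumes "P \<in> Obj L" "Q \<in> Obj L" "R \<in> Obj L"
    and "h \<in> transporter S P Q" "g \<in> transporter S Q R"
  shows "hat L Q R g \<cdot>\<^bsub>L\<^esub> hat L P Q h = hat L P R (g \<otimes> h)"
  using hats assms by (simp add: hat_system_def)

text \<open>Composites nest to the right, so two adjacent hats followed by a further morphism do not
  form a subterm to which \<open>hat_hat\<close> applies; this version merges or splits them
  there.\<close>

lemma hat_hat_Cmp:
  assumes "P \<in> Obj L" "Q \<in> Obj L" "R \<in> Obj L"
    and "h \<in> transporter S P Q" "g \<in> transporter S Q R" and "f \<in> Mor L O' P"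
  shows "hat L Q R g \<cdot>\<^bsub>L\<^esub> hat L P Q h \<cdot>\<^bsub>L\<^esub> f = hat L P R (g \<otimes> h) \<cdot>\<^bsub>L\<^esub> f"
  using assms Cmp_assoc[OF category assms(6) hat_Mor hat_Mor, of Q h R g] hat_hat[of P Q R h g]
  by simp

lemma member_transporter:
  assumes "P \<in> Obj L" "g \<in> P"
  shows "g \<in> transporter S P P"
proof -
  interpret P: subgroup P S using Obj_subgroup[OF assms(1)] .
  show ?thesis using assms(2) by (auto simp: transporter_def cj_def)
qed

text \<open>An invertible idempotent is the identity.\<close>

lemma hat_one:
  assumes P: "P \<in> Obj L"
  shows "hat L P P \<one> = Ide L P"
proof -
  have 1: "\<one> \<in> P" using Obj_subgroup[OF P] by (rule subgroup.one_closed)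
  let ?e = "hat L P P \<one>"
  have e: "?e \<in> Mor L P P" and ee: "?e \<cdot>\<^bsub>L\<^esub> ?e = ?e"
    using hat_Mor hat_hat member_transporter P 1 by auto
  \<comment> \<open>Invertibility comes from \<open>dlt\<close>: on elements of \<open>P\<close> the
    hat agrees with \<open>dlt L P\<close>, whose values are automorphisms.\<close>
  have "dlt L P \<in> mon (subgrp S P) (Aut_cat L P)" and "?e = dlt L P \<one>"
    using linking hats P 1 by (simp_all add: linking_system_def hat_system_def)
  then have "?e \<in> carrier (Aut_cat L P)"
    using 1 by (auto simp: mon_def hom_def Pi_def)
  then obtain d where d: "d \<in> Mor L P P" "d \<cdot>\<^bsub>L\<^esub> ?e = Ide L P"
    by (auto simp: Aut_cat_def is_inverse_def Mor_def)
  have "?e = (d \<cdot>\<^bsub>L\<^esub> ?e) \<cdot>\<^bsub>L\<^esub> ?e"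
    using d Ide_Cmp[OF category e] by simp
  also have "\<dots> = Ide L P"
    using Cmp_assoc[OF category e e d(1)] ee d(2) by simp
  finally show ?thesis .
qed

text \<open>Because \<open>Q\<close> is the whole image of \<open>P\<close>, and not merely a group
  containing it, the inverse of \<open>g\<close> transports back.\<close>

lemma conj_transporter:
  assumes "g \<in> carrier S" "P \<subseteq> carrier S" "Q = cj S g ` P"
  shows "g \<in> transporter S P Q" "inv g \<in> transporter S Q P"
  using assms(1,3) cj_image_inv[OF assms] by (simp_all add: transporter_def)

text \<open>Both composites of the two hats are hats of the unit, hence identities by
  \<open>hat_one\<close>. This turns the \<open>inverse_arr\<close> in the definition of
  \<open>special\<close> into another hat.\<close>

lemma inverse_hat:
  assumes P: "P \<in> Obj L" and Q: "Q \<in> Obj L" and g: "g \<in> carrier S" "Q = cj S g ` P"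
  shows "inverse_arr L (hat L P Q g) = hat L Q P (inv g)"
proof -
  note t = conj_transporter[OF g(1) subgroup.subset[OF Obj_subgroup[OF P]] g(2)]
  show ?thesis
    using P Q g(1) t
    by (intro inverse_arr_eqI[OF category, of _ P Q]) (simp_all add: hat_Mor hat_hat hat_one)
qed

end


section \<open>Special operations\<close>

lemma representativesD:
  assumes "representatives rep A M"
  shows "M \<subseteq> A" "x \<in> A \<Longrightarrow> \<exists>y. y \<in> M \<and> rep x y"
  using assms by (auto simp: representatives_def dest!: bspec[of A _ x] ex1_implies_ex)

theorem mainTheorem8:
  fixes p :: nat
    and S :: "('a, 'b) monoid_scheme"
    and F :: "'a homs"
    and L :: "('a, 'm, 'z) linking_scheme"
    and \<R> \<P> :: "'a set set"
    and \<M> :: "'a set \<Rightarrow> 'a set \<Rightarrow> 'm set"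
    and \<Psi> :: "'m \<Rightarrow> 'm"
    and \<psi> :: "'a \<Rightarrow> 'a"
  assumes "p_local_compact_group p S F L"
    and "\<R> = H_bullet_centric p S F"
    and "representatives (\<lambda>P P'. \<exists>g \<in> carrier S. P = cj S g ` P') \<R> \<P>"
    and "\<And>P Q. P \<in> \<P> \<Longrightarrow> Q \<in> \<P> \<Longrightarrow>
           representatives (\<lambda>\<phi> \<phi>'. \<exists>g \<in> normalizer S Q. \<phi> = hat L Q Q g \<cdot>\<^bsub>L\<^esub> \<phi>')
             (Mor L P Q) (\<M> P Q)"
    and "(\<Psi>, \<psi>) \<in> Ad p S F L"
    and "\<And>P. P \<in> \<P> \<Longrightarrow> \<psi> ` P = P"
    and "\<And>P. P \<in> \<P> \<Longrightarrow>
           restrict \<psi> (normalizer S P) \<in> auto (subgrp S (normalizer S P)) \<and>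
           (\<forall>g \<in> normalizer S P. \<psi> g \<in> id_comp p S P #>\<^bsub>S\<^esub> g)"
    and "\<And>P Q \<phi>. P \<in> \<P> \<Longrightarrow> Q \<in> \<P> \<Longrightarrow> \<phi> \<in> \<M> P Q \<Longrightarrow> \<Psi> \<phi> = \<phi>"
  shows "special p S L \<R> (\<Psi>, \<psi>)"
proof -
  have "group S" and "linking_system S F L" and "hat_system S L"
    using assms(1)
    by (auto simp: p_local_compact_group_def fusion_system_def discrete_p_toral_def)
  then interpret hat_linking S F L
    by (simp add: hat_linking_def hat_linking_axioms_def)
  let ?T = "id_comp p S (carrier S)"
  let ?rep = "\<lambda>P P'. \<exists>g \<in> carrier S. P = cj S g ` P'"
  have R_Obj: "P \<in> Obj L" if "P \<in> \<R>" for P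
    using that assms(2) by (simp add: H_bullet_centric_def Obj_eq)
  have P_R: "\<P> \<subseteq> \<R>" and "\<And>P. P \<in> \<R> \<Longrightarrow> \<exists>P'. P' \<in> \<P> \<and> ?rep P P'"
    using representativesD[OF assms(3)] by simp_all
  \<comment> \<open>Choice functions: \<open>r P\<close> is the representative of the class of
    \<open>P\<close>, and \<open>g P\<close> conjugates \<open>r P\<close> onto
    \<open>P\<close>.\<close>
  then obtain r g where r: "\<And>P. P \<in> \<R> \<Longrightarrow> r P \<in> \<P>"
    and g: "\<And>P. P \<in> \<R> \<Longrightarrow> g P \<in> carrier S" "\<And>P. P \<in> \<R> \<Longrightarrow> P = cj S (g P) ` r P"
    by metis
  have \<psi>: "\<psi> \<in> auto S" and \<psi>_T: "\<And>x. x \<in> carrier S \<Longrightarrow> \<psi> x \<in> ?T #>\<^bsub>S\<^esub> x"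
    and fct: "is_functor L L (\<lambda>P. \<psi> ` P) \<Psi>"
    and \<Psi>_hat: "\<And>P Q x. P \<in> Obj L \<Longrightarrow> Q \<in> Obj L \<Longrightarrow> x \<in> transporter S P Q \<Longrightarrow>
                   \<Psi> (hat L P Q x) = hat L (\<psi> ` P) (\<psi> ` Q) (\<psi> x)"
    using assms(5) by (auto simp: Ad_def Ad_fus_def Ad_S_def)
  have \<Psi>_Cmp: "\<And>P Q R f f'. f \<in> Mor L P Q \<Longrightarrow> f' \<in> Mor L Q R \<Longrightarrow>
                   \<Psi> (f' \<cdot>\<^bsub>L\<^esub> f) = \<Psi> f' \<cdot>\<^bsub>L\<^esub> \<Psi> f"
    and \<Psi>_Obj: "\<And>P. P \<in> Obj L \<Longrightarrow> \<psi> ` P \<in> Obj L"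
    using functor_Cmp[OF fct] fct by (simp_all add: is_functor_def)
  interpret \<psi>: group_hom S S \<psi>
    using \<psi> by unfold_locales (simp add: auto_def)
  have \<psi>_cj: "\<psi> ` cj S x ` P = cj S (\<psi> x) ` \<psi> ` P" if "x \<in> carrier S" "P \<subseteq> carrier S" for x P
    unfolding image_image using that by (intro image_cong) (auto simp: cj_def subset_eq)
  define \<tau> where "\<tau> P = \<psi> (g P) \<otimes>\<^bsub>S\<^esub> inv\<^bsub>S\<^esub> (g P)" for P
  have \<tau>_carrier: "\<tau> P \<in> carrier S" and \<psi>_g: "\<psi> (g P) = \<tau> P \<otimes>\<^bsub>S\<^esub> g P" if "P \<in> \<R>" for P
    using g(1)[OF that] by (auto simp: \<tau>_def m_assoc)
  have \<tau>_T: "\<tau> P \<in> ?T" if P: "P \<in> \<R>" for P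
  proof -
    obtain t where t: "t \<in> ?T" "\<psi> (g P) = t \<otimes>\<^bsub>S\<^esub> g P"
      using \<psi>_T[OF g(1)[OF P]] by (auto simp: r_coset_def)
    moreover have "t \<in> carrier S" using subsetD[OF id_comp_subset t(1)] .
    ultimately show ?thesis
      using g(1)[OF P] by (simp add: \<tau>_def m_assoc)
  qed
  have \<psi>_image: "\<psi> ` P = cj S (\<tau> P) ` P" if P: "P \<in> \<R>" for P
  proof -
    have sub: "r P \<subseteq> carrier S"
      using subgroup.subset[OF Obj_subgroup[OF R_Obj[OF subsetD[OF P_R r[OF P]]]]] .
    \<comment> \<open>Apply \<open>\<psi>\<close> to \<open>P\<close> written as a conjugate of
      \<open>r P\<close>; \<open>\<psi>\<close> preserves \<open>r P\<close>, so only the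
      conjugating element changes.\<close>
    have "\<psi> ` P = cj S (\<psi> (g P)) ` \<psi> ` r P"
      using \<psi>_cj[OF g(1)[OF P] sub] g(2)[OF P, symmetric] by simp
    also have "\<dots> = cj S (\<tau> P \<otimes>\<^bsub>S\<^esub> g P) ` r P"
      using assms(6)[OF r[OF P]] \<psi>_g[OF P] by simp
    also have "\<dots> = cj S (\<tau> P) ` P"
      using cj_image_mult[OF \<tau>_carrier[OF P] g(1)[OF P] sub] g(2)[OF P, symmetric] by simp
    finally show ?thesis .
  qed
  have core: "\<exists>a \<in> id_comp p S Q. \<Psi> \<phi> = hat L Q Q a \<cdot>\<^bsub>L\<^esub> \<phi>"
    if PQ: "P \<in> \<P>" "Q \<in> \<P>" and \<phi>: "\<phi> \<in> Mor L P Q" for P Q \<phi>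
  proof -
    have Q: "Q \<in> Obj L" using R_Obj[OF subsetD[OF P_R PQ(2)]] .
    have norm: "normalizer S Q = {x \<in> carrier S. cj S x ` Q = Q}"
      using normalizer_eq[OF subgroup.subset[OF Obj_subgroup[OF Q]]] .
    have "\<M> P Q \<subseteq> Mor L P Q"
      and "\<exists>\<mu>. \<mu> \<in> \<M> P Q \<and> (\<exists>n \<in> normalizer S Q. \<phi> = hat L Q Q n \<cdot>\<^bsub>L\<^esub> \<mu>)"
      using representativesD[OF assms(4)[OF PQ]] \<phi> by simp_all
    then obtain \<mu> n where \<mu>: "\<mu> \<in> \<M> P Q" "\<mu> \<in> Mor L P Q"
      and n: "n \<in> normalizer S Q" and \<phi>_eq: "\<phi> = hat L Q Q n \<cdot>\<^bsub>L\<^esub> \<mu>"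
      by blast
    \<comment> \<open>\<open>a\<close> is the quotient of \<open>\<psi> n\<close> by
      \<open>n\<close>; hypothesis (2) places it in the identity component of
      \<open>Q\<close>.\<close>
    obtain a where a: "a \<in> id_comp p S Q" "\<psi> n = a \<otimes>\<^bsub>S\<^esub> n"
      using assms(7)[OF PQ(2)] n by (auto simp: r_coset_def)
    have nt: "n \<in> transporter S Q Q" and at: "a \<in> transporter S Q Q"
      using n member_transporter[OF Q subsetD[OF id_comp_subset a(1)]]
      unfolding norm by (simp_all add: transporter_def)
    \<comment> \<open>By functoriality \<open>\<Psi>\<close> acts on the two factors separately: it
      fixes \<open>\<mu>\<close>, and it sends the hat of \<open>n\<close> to the hat of
      \<open>\<psi> n\<close>, still an endomorphism of \<open>Q\<close> since \<open>\<psi>\<close>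
      preserves \<open>Q\<close>.\<close>
    have "\<Psi> \<phi> = hat L Q Q (a \<otimes>\<^bsub>S\<^esub> n) \<cdot>\<^bsub>L\<^esub> \<mu>"
      using \<Psi>_Cmp[OF \<mu>(2) hat_Mor[OF Q Q nt]] \<Psi>_hat[OF Q Q nt] assms(6)[OF PQ(2)]
        assms(8)[OF PQ \<mu>(1)] a(2) \<phi>_eq by simp
    also have "\<dots> = hat L Q Q a \<cdot>\<^bsub>L\<^esub> \<phi>"
      using hat_hat_Cmp[OF Q Q Q nt at \<mu>(2)] \<phi>_eq by simp
    finally show ?thesis using a(1) by blast
  qed
  have main: "\<exists>s \<in> id_comp p S Q. \<Psi> \<phi> = hat L Q (\<psi> ` Q) (\<tau> Q) \<cdot>\<^bsub>L\<^esub> hat L Q Q s \<cdot>\<^bsub>L\<^esub> \<phi>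
               \<cdot>\<^bsub>L\<^esub> inverse_arr L (hat L P (\<psi> ` P) (\<tau> P))"
    if PR: "P \<in> \<R>" and QR: "Q \<in> \<R>" and \<phi>: "\<phi> \<in> Mor L P Q" for P Q \<phi>
  proof -
    let ?P = "r P" and ?Q = "r Q"
    have P: "P \<in> Obj L" and Q: "Q \<in> Obj L" and P': "?P \<in> Obj L" and Q': "?Q \<in> Obj L"
      and \<psi>P: "\<psi> ` P \<in> Obj L" and \<psi>Q: "\<psi> ` Q \<in> Obj L"
      using PR QR r subsetD[OF P_R] R_Obj \<Psi>_Obj by simp_all
    note car = subgroup.subset[OF Obj_subgroup]
    note gP = conj_transporter[OF g(1)[OF PR] car[OF P'] g(2)[OF PR]]
    note gQ = conj_transporter[OF g(1)[OF QR] car[OF Q'] g(2)[OF QR]]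
    note tP = conj_transporter[OF \<tau>_carrier[OF PR] car[OF P] \<psi>_image[OF PR]]
    note tQ = conj_transporter[OF \<tau>_carrier[OF QR] car[OF Q] \<psi>_image[OF QR]]
    note closed = g(1)[OF PR] g(1)[OF QR] \<tau>_carrier[OF PR] \<tau>_carrier[OF QR]
    \<comment> \<open>\<open>\<phi>'\<close> is \<open>\<phi>\<close> carried over to the
      representatives \<open>r P\<close> and \<open>r Q\<close>, where \<open>core\<close>
      applies.\<close>
    define \<phi>' where "\<phi>' = hat L Q ?Q (inv\<^bsub>S\<^esub> (g Q)) \<cdot>\<^bsub>L\<^esub> \<phi> \<cdot>\<^bsub>L\<^esub> hat L ?P P (g P)"
    have \<phi>g: "\<phi> \<cdot>\<^bsub>L\<^esub> hat L ?P P (g P) \<in> Mor L ?P Q"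
      using Cmp_Mor[OF category hat_Mor[OF P' P gP(1)] \<phi>] .
    have \<phi>': "\<phi>' \<in> Mor L ?P ?Q"
      unfolding \<phi>'_def using Cmp_Mor[OF category \<phi>g hat_Mor[OF Q Q' gQ(2)]] .
    have "hat L ?Q Q (g Q) \<cdot>\<^bsub>L\<^esub> \<phi>' = \<phi> \<cdot>\<^bsub>L\<^esub> hat L ?P P (g P)"
      unfolding \<phi>'_def using hat_hat_Cmp[OF Q Q' Q gQ(2,1) \<phi>g] closed hat_one[OF Q]
        Ide_Cmp[OF category \<phi>g] by simp
    moreover have "(\<phi> \<cdot>\<^bsub>L\<^esub> hat L ?P P (g P)) \<cdot>\<^bsub>L\<^esub> hat L P ?P (inv\<^bsub>S\<^esub> (g P)) = \<phi>"
      using Cmp_assoc[OF category hat_Mor[OF P P' gP(2)] hat_Mor[OF P' P gP(1)] \<phi>]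
        hat_hat[OF P P' P gP(2,1)] closed hat_one[OF P] Ide_Cmp[OF category \<phi>] by simp
    ultimately have \<phi>_eq: "\<phi> = hat L ?Q Q (g Q) \<cdot>\<^bsub>L\<^esub> \<phi>' \<cdot>\<^bsub>L\<^esub> hat L P ?P (inv\<^bsub>S\<^esub> (g P))"
      using Cmp_assoc[OF category hat_Mor[OF P P' gP(2)] \<phi>' hat_Mor[OF Q' Q gQ(1)]] by simp
    obtain a where a: "a \<in> id_comp p S ?Q" "\<Psi> \<phi>' = hat L ?Q ?Q a \<cdot>\<^bsub>L\<^esub> \<phi>'"
      using core[OF r[OF PR] r[OF QR] \<phi>'] by blast
    \<comment> \<open>The correction \<open>a\<close> lives over \<open>r Q\<close>. Conjugating by
      \<open>g Q\<close> gives its counterpart over \<open>Q\<close>, and the relation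
      \<open>sg\<close> below lets it pass from the right of \<open>g Q\<close> to the left.\<close>
    define s where "s = cj S (g Q) a"
    have s: "s \<in> id_comp p S Q"
      unfolding s_def
      using cj_id_comp[OF Obj_subgroup[OF Q'] Obj_subgroup[OF Q] g(1)[OF QR] g(2)[OF QR] a(1)] .
    have ac: "a \<in> carrier S" and at: "a \<in> transporter S ?Q ?Q"
      and st: "s \<in> transporter S Q Q"
      using subsetD[OF id_comp_subset a(1)] subsetD[OF id_comp_subset s]
        Obj_carrier[OF Q'] member_transporter[OF Q'] member_transporter[OF Q] by simp_all
    have sg: "s \<otimes>\<^bsub>S\<^esub> g Q = g Q \<otimes>\<^bsub>S\<^esub> a"
      unfolding s_def cj_def using closed ac by (simp add: m_assoc)
    \<comment> \<open>\<open>\<beta>\<close> has two readings. It is the image under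
      \<open>\<Psi>\<close> of the hat of the inverse of \<open>g P\<close>, as
      \<open>\<psi> (g P)\<close> is the product of \<open>\<tau> P\<close> and \<open>g P\<close>;
      by \<open>\<beta>_eq\<close> it is also a composite through \<open>P\<close>. The first serves
      to evaluate \<open>\<Psi> \<phi>\<close>, the second to reassemble
      \<open>\<phi>\<close>.\<close>
    define \<beta> where "\<beta> = hat L (\<psi> ` P) ?P (inv\<^bsub>S\<^esub> (g P) \<otimes>\<^bsub>S\<^esub> inv\<^bsub>S\<^esub> (\<tau> P))"
    have \<beta>: "\<beta> \<in> Mor L (\<psi> ` P) ?P"
      and \<beta>_eq: "hat L P ?P (inv\<^bsub>S\<^esub> (g P)) \<cdot>\<^bsub>L\<^esub> hat L (\<psi> ` P) P (inv\<^bsub>S\<^esub> (\<tau> P)) = \<beta>"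
      unfolding \<beta>_def
      using hat_Mor[OF \<psi>P P' transporter_mult[OF car[OF \<psi>P] tP(2) gP(2)]]
        hat_hat[OF \<psi>P P P' tP(2) gP(2)] .
    have \<phi>'\<beta>: "\<phi>' \<cdot>\<^bsub>L\<^esub> \<beta> \<in> Mor L (\<psi> ` P) ?Q"
      using Cmp_Mor[OF category \<beta> \<phi>'] .
    note tg = transporter_mult[OF car[OF Q'] gQ(1) tQ(1)]
    have "\<Psi> \<phi> = \<Psi> (hat L ?Q Q (g Q)) \<cdot>\<^bsub>L\<^esub> \<Psi> \<phi>' \<cdot>\<^bsub>L\<^esub> \<Psi> (hat L P ?P (inv\<^bsub>S\<^esub> (g P)))"
      unfolding \<phi>_eq[THEN arg_cong[where f = \<Psi>]]
      using \<Psi>_Cmp[OF Cmp_Mor[OF category hat_Mor[OF P P' gP(2)] \<phi>'] hat_Mor[OF Q' Q gQ(1)]]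
        \<Psi>_Cmp[OF hat_Mor[OF P P' gP(2)] \<phi>'] by simp
    also have "\<Psi> (hat L ?Q Q (g Q)) = hat L ?Q (\<psi> ` Q) (\<tau> Q \<otimes>\<^bsub>S\<^esub> g Q)"
      using \<Psi>_hat[OF Q' Q gQ(1)] assms(6)[OF r[OF QR]] \<psi>_g[OF QR] by simp
    also have "\<Psi> (hat L P ?P (inv\<^bsub>S\<^esub> (g P))) = \<beta>"
      using \<Psi>_hat[OF P P' gP(2)] assms(6)[OF r[OF PR]] \<psi>_g[OF PR] closed
      by (simp add: \<beta>_def inv_mult_group)
    also have "\<Psi> \<phi>' \<cdot>\<^bsub>L\<^esub> \<beta> = hat L ?Q ?Q a \<cdot>\<^bsub>L\<^esub> \<phi>' \<cdot>\<^bsub>L\<^esub> \<beta>"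
      using a(2) Cmp_assoc[OF category \<beta> \<phi>' hat_Mor[OF Q' Q' at]] by simp
    also have "hat L ?Q (\<psi> ` Q) (\<tau> Q \<otimes>\<^bsub>S\<^esub> g Q) \<cdot>\<^bsub>L\<^esub> hat L ?Q ?Q a \<cdot>\<^bsub>L\<^esub> \<phi>' \<cdot>\<^bsub>L\<^esub> \<beta>
        = hat L ?Q (\<psi> ` Q) (\<tau> Q \<otimes>\<^bsub>S\<^esub> (s \<otimes>\<^bsub>S\<^esub> g Q)) \<cdot>\<^bsub>L\<^esub> \<phi>' \<cdot>\<^bsub>L\<^esub> \<beta>"
      using hat_hat_Cmp[OF Q' Q' \<psi>Q at tg \<phi>'\<beta>] closed ac by (simp add: sg m_assoc)
    also have "\<dots> = hat L Q (\<psi> ` Q) (\<tau> Q) \<cdot>\<^bsub>L\<^esub> hat L Q Q s \<cdot>\<^bsub>L\<^esub> hat L ?Q Q (g Q)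
        \<cdot>\<^bsub>L\<^esub> \<phi>' \<cdot>\<^bsub>L\<^esub> \<beta>"
      using hat_hat_Cmp[OF Q' Q Q gQ(1) st \<phi>'\<beta>]
        hat_hat_Cmp[OF Q' Q \<psi>Q transporter_mult[OF car[OF Q'] gQ(1) st] tQ(1) \<phi>'\<beta>] by simp
    \<comment> \<open>Once \<open>\<beta>\<close> is split through \<open>P\<close>, the first three
      factors are those of \<open>\<phi>_eq\<close>. What remains is the hat of the inverse of
      \<open>\<tau> P\<close>, which \<open>inverse_hat\<close> identifies with the required
      inverse.\<close>
    also have "hat L ?Q Q (g Q) \<cdot>\<^bsub>L\<^esub> \<phi>' \<cdot>\<^bsub>L\<^esub> \<beta>
        = \<phi> \<cdot>\<^bsub>L\<^esub> inverse_arr L (hat L P (\<psi> ` P) (\<tau> P))"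
    proof -
      note i = hat_Mor[OF P P' gP(2)] and t = hat_Mor[OF \<psi>P P tP(2)]
      have "hat L ?Q Q (g Q) \<cdot>\<^bsub>L\<^esub> \<phi>' \<cdot>\<^bsub>L\<^esub> \<beta>
          = (hat L ?Q Q (g Q) \<cdot>\<^bsub>L\<^esub> \<phi>' \<cdot>\<^bsub>L\<^esub> hat L P ?P (inv\<^bsub>S\<^esub> (g P))) \<cdot>\<^bsub>L\<^esub>
            hat L (\<psi> ` P) P (inv\<^bsub>S\<^esub> (\<tau> P))"
        using Cmp_assoc[OF category t i \<phi>'] \<beta>_eq
          Cmp_assoc[OF category t Cmp_Mor[OF category i \<phi>'] hat_Mor[OF Q' Q gQ(1)]] by simp
      then show ?thesis
        using \<phi>_eq inverse_hat[OF P \<psi>P \<tau>_carrier[OF PR] \<psi>_image[OF PR]] by simp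
    qed
    finally show ?thesis using s by blast
  qed
  \<comment> \<open>\<open>\<sigma>\<close> depends on the morphism alone, whose source and target are recorded by \<open>Dom\<close> and \<open>Cod\<close>.\<close>
  define \<sigma> where "\<sigma> \<phi> = (SOME s. s \<in> id_comp p S (Cod L \<phi>) \<and>
      \<Psi> \<phi> = hat L (Cod L \<phi>) (\<psi> ` Cod L \<phi>) (\<tau> (Cod L \<phi>)) \<cdot>\<^bsub>L\<^esub> hat L (Cod L \<phi>) (Cod L \<phi>) s
        \<cdot>\<^bsub>L\<^esub> \<phi> \<cdot>\<^bsub>L\<^esub> inverse_arr L (hat L (Dom L \<phi>) (\<psi> ` Dom L \<phi>) (\<tau> (Dom L \<phi>))))" for \<phi>
  have "\<sigma> \<phi> \<in> id_comp p S Q \<and> \<Psi> \<phi> = hat L Q (\<psi> ` Q) (\<tau> Q) \<cdot>\<^bsub>L\<^esub> hat L Q Q (\<sigma> \<phi>) \<cdot>\<^bsub>L\<^esub> \<phi>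
               \<cdot>\<^bsub>L\<^esub> inverse_arr L (hat L P (\<psi> ` P) (\<tau> P))"
    if "P \<in> \<R>" "Q \<in> \<R>" "\<phi> \<in> Mor L P Q" for P Q \<phi>
  proof -
    have "Dom L \<phi> = P" "Cod L \<phi> = Q" using that(3) by (auto simp: Mor_def)
    then show ?thesis
      using someI_ex[OF main[OF that, unfolded Bex_def]] by (simp add: \<sigma>_def)
  qed
  then show ?thesis
    unfolding special_def using \<tau>_T \<psi>_image by (auto intro!: exI[of _ \<tau>] exI[of _ \<sigma>])
qed

end
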